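(* Let $\alpha_0,\alpha_1,\alpha_2,\eta$ be complex parameters with $\alpha_0+\alpha_1+\alpha_2=1$, and consider the system $$\begin{aligned} \frac{dx}{dt}&=-(xw-\alpha_2)x+\frac12,\\ \frac{dy}{dt}&=(xw+zq-1)y+\alpha_1 wq,\\ \frac{dz}{dt}&=-(zq-\alpha_0)z-\frac{\eta}{2},\\ \frac{dw}{dt}&=(xw-zq-\alpha_2)w+yz,\\ \frac{dq}{dt}&=(zq-xw-\alpha_0)q+xy. \end{aligned}$$ By the transformations $$q_1=w,\quad p_1=x,\quad q_2=e^{t}q,\quad p_2=\frac{z}{e^{t}},\quad s=\frac{1}{e^{t}},$$ elimination of $y$ from this system by means of the relation $y-wq=e^{-t}$ gives the 2-parameter family of coupled Hamiltonian systems in dimension four $$\begin{aligned} \frac{dq_1}{ds}&=\frac{\partial H}{\partial p_1}=-\frac{q_1^2p_1}{s}+\frac{\alpha_2q_1}{s}-\frac{p_2}{s},\\ \frac{dp_1}{ds}&=-\frac{\partial H}{\partial q_1}=\frac{q_1p_1^2}{s}-\frac{\alpha_2p_1}{s}-\frac{1}{2s},\\ \frac{dq_2}{ds}&=\frac{\partial H}{\partial p_2}=-\frac{q_2^2p_2}{s}-\frac{(\alpha_1+\alpha_2)q_2}{s}-\frac{p_1}{s},\\ \frac{dp_2}{ds}&=-\frac{\partial H}{\partial q_2}=\frac{q_2p_2^2}{s}+\frac{(\alpha_1+\alpha_2)p_2}{s}+\frac{\eta}{2} \end{aligned}$$ with the polynomial Hamiltonian $$\begin{aligned}H&=K_1(q_1,p_1,s;\alpha_2)+K_2(q_2,p_2,s;\alpha_1+\alpha_2)-\frac{p_1p_2}{s}\\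 &=-\frac{q_1^2p_1^2-2\alpha_2q_1p_1-q_1}{2s}-\frac{q_2^2p_2^2+2(\alpha_1+\alpha_2)q_2p_2+\eta sq_2}{2s}-\frac{p_1p_2}{s}.\end{aligned}$$
   Context: Here $x,y,z,w,q$ are unknown complex functions of the complex variable $t$. The symbols $K_1,K_2$ denote $$K_1(q_1,p_1,s;\alpha)=-\frac{q_1^2p_1^2-2\alpha q_1p_1-q_1}{2s},\qquad K_2(q_2,p_2,s;\alpha)=-\frac{q_2^2p_2^2+2\alpha q_2p_2+\eta sq_2}{2s}.$$ Along solutions of the five-dimensional system $\frac{d(y-wq)}{dt}=-(y-wq)$; the elimination of $y$ is carried out for solutions normalized by $y-wq=e^{-t}$. "Polynomial Hamiltonian" means polynomial in $q_1,p_1,q_2,p_2$ with coefficients rational in $s$. *)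

theory Defs
  imports "HOL-Analysis.Analysis" "HOL-Computational_Algebra.Polynomial"
begin

definition K1 :: "complex \<Rightarrow> complex \<Rightarrow> complex \<Rightarrow> complex \<Rightarrow> complex" where
  "K1 q1 p1 s \<alpha> = - (q1\<^sup>2 * p1\<^sup>2 - 2 * \<alpha> * q1 * p1 - q1) / (2 * s)"

definition K2 :: "complex \<Rightarrow> complex \<Rightarrow> complex \<Rightarrow> complex \<Rightarrow> complex \<Rightarrow> complex" where
  "K2 \<eta> q2 p2 s \<alpha> = - (q2\<^sup>2 * p2\<^sup>2 + 2 * \<alpha> * q2 * p2 + \<eta> * s * q2) / (2 * s)"

definition Ham :: "complex \<Rightarrow> complex \<Rightarrow> complex \<Rightarrow>
    complex \<Rightarrow> complex \<Rightarrow> complex \<Rightarrow> complex \<Rightarrow> complex \<Rightarrow> complex" where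
  "Ham \<eta> \<alpha>1 \<alpha>2 q1 p1 q2 p2 s = K1 q1 p1 s \<alpha>2 + K2 \<eta> q2 p2 s (\<alpha>1 + \<alpha>2) - p1 * p2 / s"

text \<open>Polynomial in \<open>q1, p1, q2, p2\<close> with coefficients that are rational functions
  of \<open>s\<close>, regular away from the singular point \<open>s = 0\<close>.\<close>

definition polynomial_hamiltonian ::
    "(complex \<Rightarrow> complex \<Rightarrow> complex \<Rightarrow> complex \<Rightarrow> complex \<Rightarrow> complex) \<Rightarrow> bool" where
  "polynomial_hamiltonian H \<longleftrightarrow>
    (\<exists>(N::nat) (a :: nat \<Rightarrow> nat \<Rightarrow> nat \<Rightarrow> nat \<Rightarrow> complex poly) (b :: nat \<Rightarrow> nat \<Rightarrow> nat \<Rightarrow> nat \<Rightarrow> complex poly).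
      \<forall>s. s \<noteq> 0 \<longrightarrow>
        (\<forall>i j k l. poly (b i j k l) s \<noteq> 0) \<and>
        (\<forall>q1 p1 q2 p2. H q1 p1 q2 p2 s =
          (\<Sum>i\<le>N. \<Sum>j\<le>N. \<Sum>k\<le>N. \<Sum>l\<le>N.
            poly (a i j k l) s / poly (b i j k l) s * q1 ^ i * p1 ^ j * q2 ^ k * p2 ^ l)))"

definition solves_5d :: "complex \<Rightarrow> complex \<Rightarrow> complex \<Rightarrow> complex \<Rightarrow> complex set \<Rightarrow>
    (complex \<Rightarrow> complex) \<Rightarrow> (complex \<Rightarrow> complex) \<Rightarrow> (complex \<Rightarrow> complex) \<Rightarrow>
    (complex \<Rightarrow> complex) \<Rightarrow> (complex \<Rightarrow> complex) \<Rightarrow> bool" where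
  "solves_5d \<alpha>0 \<alpha>1 \<alpha>2 \<eta> T x y z w q \<longleftrightarrow> (\<forall>t\<in>T.
    (x has_field_derivative - (x t * w t - \<alpha>2) * x t + 1 / 2) (at t) \<and>
    (y has_field_derivative (x t * w t + z t * q t - 1) * y t + \<alpha>1 * w t * q t) (at t) \<and>
    (z has_field_derivative - (z t * q t - \<alpha>0) * z t - \<eta> / 2) (at t) \<and>
    (w has_field_derivative (x t * w t - z t * q t - \<alpha>2) * w t + y t * z t) (at t) \<and>
    (q has_field_derivative (z t * q t - x t * w t - \<alpha>0) * q t + x t * y t) (at t))"

definition solves_hamiltonian ::
    "(complex \<Rightarrow> complex \<Rightarrow> complex \<Rightarrow> complex \<Rightarrow> complex \<Rightarrow> complex) \<Rightarrow> complex set \<Rightarrow>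
     (complex \<Rightarrow> complex) \<Rightarrow> (complex \<Rightarrow> complex) \<Rightarrow> (complex \<Rightarrow> complex) \<Rightarrow> (complex \<Rightarrow> complex) \<Rightarrow> bool" where
  "solves_hamiltonian H S q1 p1 q2 p2 \<longleftrightarrow> (\<forall>s\<in>S.
    (q1 has_field_derivative deriv (\<lambda>p. H (q1 s) p (q2 s) (p2 s) s) (p1 s)) (at s) \<and>
    (p1 has_field_derivative - deriv (\<lambda>q. H q (p1 s) (q2 s) (p2 s) s) (q1 s)) (at s) \<and>
    (q2 has_field_derivative deriv (\<lambda>p. H (q1 s) (p1 s) (q2 s) p s) (p2 s)) (at s) \<and>
    (p2 has_field_derivative - deriv (\<lambda>q. H (q1 s) (p1 s) q (p2 s) s) (q2 s)) (at s))"

definition solves_4d :: "complex \<Rightarrow> complex \<Rightarrow> complex \<Rightarrow> complex set \<Rightarrow>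
    (complex \<Rightarrow> complex) \<Rightarrow> (complex \<Rightarrow> complex) \<Rightarrow> (complex \<Rightarrow> complex) \<Rightarrow> (complex \<Rightarrow> complex) \<Rightarrow> bool" where
  "solves_4d \<alpha>1 \<alpha>2 \<eta> S q1 p1 q2 p2 \<longleftrightarrow> (\<forall>s\<in>S.
    (q1 has_field_derivative
      - (q1 s)\<^sup>2 * p1 s / s + \<alpha>2 * q1 s / s - p2 s / s) (at s) \<and>
    (p1 has_field_derivative
      q1 s * (p1 s)\<^sup>2 / s - \<alpha>2 * p1 s / s - 1 / (2 * s)) (at s) \<and>
    (q2 has_field_derivative
      - (q2 s)\<^sup>2 * p2 s / s - (\<alpha>1 + \<alpha>2) * q2 s / s - p1 s / s) (at s) \<and>
    (p2 has_field_derivative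
      q2 s * (p2 s)\<^sup>2 / s + (\<alpha>1 + \<alpha>2) * p2 s / s + \<eta> / 2) (at s))"

text \<open>The change of variables \<open>q1 = w, p1 = x, q2 = e\<^sup>t q, p2 = z / e\<^sup>t\<close>, where the new unknowns
  are functions of \<open>s = 1 / e\<^sup>t\<close>. It is stated as a relation since \<open>t \<mapsto> 1 / e\<^sup>t\<close> is
  only locally invertible.\<close>

definition change_vars :: "complex set \<Rightarrow>
    (complex \<Rightarrow> complex) \<Rightarrow> (complex \<Rightarrow> complex) \<Rightarrow> (complex \<Rightarrow> complex) \<Rightarrow> (complex \<Rightarrow> complex) \<Rightarrow>
    (complex \<Rightarrow> complex) \<Rightarrow> (complex \<Rightarrow> complex) \<Rightarrow> (complex \<Rightarrow> complex) \<Rightarrow> (complex \<Rightarrow> complex) \<Rightarrow> bool" where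
  "change_vars T x z w q q1 p1 q2 p2 \<longleftrightarrow> (\<forall>t\<in>T.
    q1 (1 / exp t) = w t \<and>
    p1 (1 / exp t) = x t \<and>
    q2 (1 / exp t) = exp t * q t \<and>
    p2 (1 / exp t) = z t / exp t)"

end

theory Submission
  imports Defs
begin

text \<open>Since \<open>s = 1 / e\<^sup>t\<close> satisfies \<open>ds/dt = - s\<close>, passing from \<open>t\<close> to \<open>s\<close> divides every
  derivative by \<open>- s\<close>. On the hypersurface \<open>y - w q = e\<^sup>-\<^sup>t\<close> the cubic terms \<open>z q w\<close> and \<open>x w q\<close>
  cancel from the equations for \<open>w\<close> and \<open>q\<close>, and the factors \<open>e\<^sup>t\<close> and \<open>1 / e\<^sup>t\<close> in \<open>q2\<close> and \<open>p2\<close>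
  absorb all remaining explicit exponentials; the linear term they produce turns the coefficient
  \<open>\<alpha>0\<close> into \<open>1 - \<alpha>0 = \<alpha>1 + \<alpha>2\<close>. Each of the equations for \<open>x\<close>, \<open>z\<close>, \<open>w\<close>, \<open>q\<close> is
  therefore equivalent to one equation of the four-dimensional system.

  Two points need care. First, \<open>t \<mapsto> 1 / e\<^sup>t\<close> is not injective, so differentiability of a
  function of \<open>s\<close> is read off through a local branch of the logarithm; this is
  \<open>has_field_derivative_exp_coordinate_iff\<close>. Secondly, the four-dimensional system has no
  equation for \<open>y\<close>: going back to five dimensions, it is recovered by differentiating
  \<open>y = w q + e\<^sup>-\<^sup>t\<close>, and it agrees with the required one precisely because
  \<open>\<alpha>0 + \<alpha>1 + \<alpha>2 = 1\<close> (\<open>y_equation_redundant\<close>).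

  The Hamiltonian form is then a computation of the four partial derivatives of the
  Hamiltonian.\<close>

text \<open>The new unknowns have the form \<open>F (1 / e\<^sup>u) = e\<^bsup>c u\<^esup> f u\<close> with weight \<open>c = 0\<close> for \<open>w\<close> and \<open>x\<close>,
  \<open>c = 1\<close> for \<open>q\<close> and \<open>c = - 1\<close> for \<open>z\<close>, so one statement with a free weight covers all of
  them. It holds because \<open>u \<mapsto> 1 / e\<^sup>u\<close> is locally invertible.\<close>

lemma has_field_derivative_exp_coordinate_iff:
  fixes F f :: "complex \<Rightarrow> complex"
  assumes T: "open T" "t \<in> T"
    and F: "\<And>u. u \<in> T \<Longrightarrow> F (1 / exp u) = exp (c * u) * f u"
  shows "(F has_field_derivative E) (at (1 / exp t)) \<longleftrightarrow>
    (f has_field_derivative - c * f t - E / (exp t * exp (c * t))) (at t)"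
proof
  assume "(F has_field_derivative E) (at (1 / exp t))"
  moreover have "((\<lambda>u. 1 / exp u) has_field_derivative - 1 / exp t) (at t)"
    by (auto intro!: derivative_eq_intros simp: field_simps)
  ultimately have "((\<lambda>u. F (1 / exp u)) has_field_derivative E * (- 1 / exp t)) (at t)"
    by (rule DERIV_chain2)
  then have "((\<lambda>u. exp (- c * u) * F (1 / exp u)) has_field_derivative
      - c * f t - E / (exp t * exp (c * t))) (at t)"
    by (auto intro!: derivative_eq_intros simp: F[OF T(2)] exp_minus field_simps)
  then show "(f has_field_derivative - c * f t - E / (exp t * exp (c * t))) (at t)"
    by (rule has_field_derivative_transform_within_open[OF _ T])
      (simp add: F exp_minus)
next
  assume f: "(f has_field_derivative - c * f t - E / (exp t * exp (c * t))) (at t)"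
  \<comment> \<open>the branch of \<open>s \<mapsto> - log s\<close> that takes the value \<open>t\<close> at \<open>1 / e\<^sup>t\<close>\<close>
  define g where "g s = t - Ln (s * exp t)" for s
  have g_t: "g (1 / exp t) = t"
    by (simp add: g_def)
  have g: "(g has_field_derivative - exp t) (at (1 / exp t))"
    unfolding g_def by (auto intro!: derivative_eq_intros)
  have g_inv: "1 / exp (g s) = s" if "s \<noteq> 0" for s
    using that by (simp add: g_def exp_diff)
  have "(g \<longlongrightarrow> t) (nhds (1 / exp t))"
    using DERIV_isCont[OF g, unfolded isCont_def tendsto_at_iff_tendsto_nhds] by (simp add: g_t)
  then have "\<forall>\<^sub>F s in nhds (1 / exp t). g s \<in> T"
    using T by (rule topological_tendstoD)
  moreover have "\<forall>\<^sub>F s in nhds (1 / exp t). s \<noteq> 0"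
    by (rule t1_space_nhds) simp
  ultimately have "\<forall>\<^sub>F s in nhds (1 / exp t). exp (c * g s) * f (g s) = F s"
    by eventually_elim (metis F g_inv)
  moreover have "((\<lambda>s. f (g s)) has_field_derivative
      (- c * f t - E / (exp t * exp (c * t))) * (- exp t)) (at (1 / exp t))"
    using f g by (intro DERIV_chain2[of f]) (simp_all add: g_t)
  then have "((\<lambda>s. exp (c * g s) * f (g s)) has_field_derivative E) (at (1 / exp t))"
    using g by (auto intro!: derivative_eq_intros simp: g_t field_simps)
  ultimately show "(F has_field_derivative E) (at (1 / exp t))"
    by (simp cong: DERIV_cong_ev)
qed

text \<open>Differentiating \<open>y = w q + e\<^sup>-\<^sup>t\<close> along the equations for \<open>w\<close> and \<open>q\<close> leaves the terms
  \<open>- (\<alpha>0 + \<alpha>2) w q\<close>, whereas the equation for \<open>y\<close> contains \<open>(\<alpha>1 - 1) w q\<close>.\<close>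

lemma y_equation_redundant:
  fixes x y z w q :: "complex \<Rightarrow> complex"
  assumes \<alpha>: "\<alpha>0 + \<alpha>1 + \<alpha>2 = 1"
    and T: "open T" "t \<in> T" and y: "\<And>u. u \<in> T \<Longrightarrow> y u - w u * q u = exp (- u)"
    and w: "(w has_field_derivative (x t * w t - z t * q t - \<alpha>2) * w t + y t * z t) (at t)"
    and q: "(q has_field_derivative (z t * q t - x t * w t - \<alpha>0) * q t + x t * y t) (at t)"
  shows "(y has_field_derivative (x t * w t + z t * q t - 1) * y t + \<alpha>1 * w t * q t) (at t)"
proof -
  have y_eq: "y u = w u * q u + exp (- u)" if "u \<in> T" for u
    using y[OF that] by (simp add: algebra_simps)
  have \<alpha>1: "\<alpha>1 = 1 - \<alpha>0 - \<alpha>2"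
    using \<alpha> by (simp add: algebra_simps)
  have "((\<lambda>u. w u * q u + exp (- u)) has_field_derivative
      (x t * w t + z t * q t - 1) * y t + \<alpha>1 * w t * q t) (at t)"
    using w q by (auto intro!: derivative_eq_intros simp: y_eq[OF T(2)] \<alpha>1 algebra_simps)
  then show ?thesis
    by (rule has_field_derivative_transform_within_open[OF _ T]) (simp add: y_eq)
qed

lemma solves_5d_iff_solves_4d:
  assumes \<alpha>: "\<alpha>0 + \<alpha>1 + \<alpha>2 = 1"
    and T: "open T" and y: "\<And>t. t \<in> T \<Longrightarrow> y t - w t * q t = exp (- t)"
    and cv: "change_vars T x z w q q1 p1 q2 p2"
  shows "solves_5d \<alpha>0 \<alpha>1 \<alpha>2 \<eta> T x y z w q \<longleftrightarrow>
    solves_4d \<alpha>1 \<alpha>2 \<eta> ((\<lambda>t. 1 / exp t) ` T) q1 p1 q2 p2"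
proof -
  have new: "q1 (1 / exp t) = w t" "p1 (1 / exp t) = x t"
    "q2 (1 / exp t) = exp t * q t" "p2 (1 / exp t) = z t / exp t" if "t \<in> T" for t
    using cv that by (auto simp: change_vars_def)
  have \<alpha>12: "\<alpha>1 + \<alpha>2 = 1 - \<alpha>0"
    using \<alpha> by (simp add: algebra_simps)
  have y_eq: "y t = w t * q t + 1 / exp t" if "t \<in> T" for t
    using y[OF that] by (simp add: exp_minus field_simps)
  let ?s = "\<lambda>t::complex. 1 / exp t"
  have w_iff: "(q1 has_field_derivative
        - (q1 (?s t))\<^sup>2 * p1 (?s t) / ?s t + \<alpha>2 * q1 (?s t) / ?s t - p2 (?s t) / ?s t) (at (?s t))
      \<longleftrightarrow> (w has_field_derivative (x t * w t - z t * q t - \<alpha>2) * w t + y t * z t) (at t)"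
    if "t \<in> T" for t
    by (subst has_field_derivative_exp_coordinate_iff[OF T that, where c = 0 and f = w])
      (simp add: new, rule arg_cong[where f = "\<lambda>D. (w has_field_derivative D) (at t)"],
        simp add: new that y_eq field_simps power2_eq_square)
  have x_iff: "(p1 has_field_derivative
        q1 (?s t) * (p1 (?s t))\<^sup>2 / ?s t - \<alpha>2 * p1 (?s t) / ?s t - 1 / (2 * ?s t)) (at (?s t))
      \<longleftrightarrow> (x has_field_derivative - (x t * w t - \<alpha>2) * x t + 1 / 2) (at t)"
    if "t \<in> T" for t
    by (subst has_field_derivative_exp_coordinate_iff[OF T that, where c = 0 and f = x])
      (simp add: new, rule arg_cong[where f = "\<lambda>D. (x has_field_derivative D) (at t)"],
        simp add: new that field_simps power2_eq_square)
  have q_iff: "(q2 has_field_derivative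
        - (q2 (?s t))\<^sup>2 * p2 (?s t) / ?s t - (\<alpha>1 + \<alpha>2) * q2 (?s t) / ?s t - p1 (?s t) / ?s t)
          (at (?s t))
      \<longleftrightarrow> (q has_field_derivative (z t * q t - x t * w t - \<alpha>0) * q t + x t * y t) (at t)"
    if "t \<in> T" for t
    by (subst has_field_derivative_exp_coordinate_iff[OF T that, where c = 1 and f = q])
      (simp add: new, rule arg_cong[where f = "\<lambda>D. (q has_field_derivative D) (at t)"],
        simp add: new that \<alpha>12 y_eq field_simps power2_eq_square)
  have z_iff: "(p2 has_field_derivative
        q2 (?s t) * (p2 (?s t))\<^sup>2 / ?s t + (\<alpha>1 + \<alpha>2) * p2 (?s t) / ?s t + \<eta> / 2) (at (?s t))
      \<longleftrightarrow> (z has_field_derivative - (z t * q t - \<alpha>0) * z t - \<eta> / 2) (at t)"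
    if "t \<in> T" for t
    by (subst has_field_derivative_exp_coordinate_iff[OF T that, where c = "- 1" and f = z])
      (simp add: new exp_minus inverse_eq_divide,
        rule arg_cong[where f = "\<lambda>D. (z has_field_derivative D) (at t)"],
        simp add: new that \<alpha>12 exp_minus field_simps power2_eq_square)
  have "solves_4d \<alpha>1 \<alpha>2 \<eta> (?s ` T) q1 p1 q2 p2 \<longleftrightarrow> (\<forall>t\<in>T.
      (w has_field_derivative (x t * w t - z t * q t - \<alpha>2) * w t + y t * z t) (at t) \<and>
      (x has_field_derivative - (x t * w t - \<alpha>2) * x t + 1 / 2) (at t) \<and>
      (q has_field_derivative (z t * q t - x t * w t - \<alpha>0) * q t + x t * y t) (at t) \<and>
      (z has_field_derivative - (z t * q t - \<alpha>0) * z t - \<eta> / 2) (at t))"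
    unfolding solves_4d_def ball_simps
    by (intro ball_cong refl) (simp only: w_iff x_iff q_iff z_iff)
  then show ?thesis
    unfolding solves_5d_def using y_equation_redundant[OF \<alpha> T _ y] by blast
qed

lemma Ham_partial_derivatives:
  assumes "s \<noteq> 0"
  shows "((\<lambda>p. Ham \<eta> \<alpha>1 \<alpha>2 q1 p q2 p2 s) has_field_derivative
      - q1\<^sup>2 * p1 / s + \<alpha>2 * q1 / s - p2 / s) (at p1)"
    and "((\<lambda>q. - Ham \<eta> \<alpha>1 \<alpha>2 q p1 q2 p2 s) has_field_derivative
      q1 * p1\<^sup>2 / s - \<alpha>2 * p1 / s - 1 / (2 * s)) (at q1)"
    and "((\<lambda>p. Ham \<eta> \<alpha>1 \<alpha>2 q1 p1 q2 p s) has_field_derivative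
      - q2\<^sup>2 * p2 / s - (\<alpha>1 + \<alpha>2) * q2 / s - p1 / s) (at p2)"
    and "((\<lambda>q. - Ham \<eta> \<alpha>1 \<alpha>2 q1 p1 q p2 s) has_field_derivative
      q2 * p2\<^sup>2 / s + (\<alpha>1 + \<alpha>2) * p2 / s + \<eta> / 2) (at q2)"
  using assms unfolding Ham_def K1_def K2_def
  by (auto intro!: derivative_eq_intros simp: field_simps power2_eq_square)

lemma solves_hamiltonian_Ham_iff_solves_4d:
  assumes "0 \<notin> S"
  shows "solves_hamiltonian (Ham \<eta> \<alpha>1 \<alpha>2) S q1 p1 q2 p2 \<longleftrightarrow> solves_4d \<alpha>1 \<alpha>2 \<eta> S q1 p1 q2 p2"
  unfolding solves_hamiltonian_def solves_4d_def
proof (intro ball_cong refl)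
  fix s assume "s \<in> S"
  with assms have "s \<noteq> 0"
    by auto
  note partials = Ham_partial_derivatives[OF this, of \<eta> \<alpha>1 \<alpha>2]
  have minus_deriv: "- deriv h a = D" if "((\<lambda>q. - h q) has_field_derivative D) (at a)"
    for h :: "complex \<Rightarrow> complex" and a D
    using DERIV_imp_deriv[OF DERIV_minus[OF that]] by simp
  show "(q1 has_field_derivative deriv (\<lambda>p. Ham \<eta> \<alpha>1 \<alpha>2 (q1 s) p (q2 s) (p2 s) s) (p1 s)) (at s) \<and>
      (p1 has_field_derivative - deriv (\<lambda>q. Ham \<eta> \<alpha>1 \<alpha>2 q (p1 s) (q2 s) (p2 s) s) (q1 s)) (at s) \<and>
      (q2 has_field_derivative deriv (\<lambda>p. Ham \<eta> \<alpha>1 \<alpha>2 (q1 s) (p1 s) (q2 s) p s) (p2 s)) (at s) \<and>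
      (p2 has_field_derivative - deriv (\<lambda>q. Ham \<eta> \<alpha>1 \<alpha>2 (q1 s) (p1 s) q (p2 s) s) (q2 s)) (at s) \<longleftrightarrow>
    (q1 has_field_derivative
      - (q1 s)\<^sup>2 * p1 s / s + \<alpha>2 * q1 s / s - p2 s / s) (at s) \<and>
    (p1 has_field_derivative
      q1 s * (p1 s)\<^sup>2 / s - \<alpha>2 * p1 s / s - 1 / (2 * s)) (at s) \<and>
    (q2 has_field_derivative
      - (q2 s)\<^sup>2 * p2 s / s - (\<alpha>1 + \<alpha>2) * q2 s / s - p1 s / s) (at s) \<and>
    (p2 has_field_derivative
      q2 s * (p2 s)\<^sup>2 / s + (\<alpha>1 + \<alpha>2) * p2 s / s + \<eta> / 2) (at s)"
    by (simp only: DERIV_imp_deriv[OF partials(1)] minus_deriv[OF partials(2)]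
        DERIV_imp_deriv[OF partials(3)] minus_deriv[OF partials(4)])
qed

text \<open>Every monomial is written over the common denominator \<open>2 s\<close>; the term \<open>\<eta> s q2\<close> is what
  makes one of the numerators a non-constant polynomial in \<open>s\<close>.\<close>

lemma polynomial_hamiltonian_Ham: "polynomial_hamiltonian (Ham \<eta> \<alpha>1 \<alpha>2)"
proof -
  define a :: "nat \<Rightarrow> nat \<Rightarrow> nat \<Rightarrow> nat \<Rightarrow> complex poly" where
    "a i j k l =
      (if (i, j, k, l) = (2, 2, 0, 0) then [:- 1:]
       else if (i, j, k, l) = (1, 1, 0, 0) then [:2 * \<alpha>2:]
       else if (i, j, k, l) = (1, 0, 0, 0) then [:1:]
       else if (i, j, k, l) = (0, 0, 2, 2) then [:- 1:]
       else if (i, j, k, l) = (0, 0, 1, 1) then [:- 2 * (\<alpha>1 + \<alpha>2):]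
       else if (i, j, k, l) = (0, 0, 1, 0) then [:0, - \<eta>:]
       else if (i, j, k, l) = (0, 1, 0, 1) then [:- 2:]
       else 0)" for i j k l
  define b :: "nat \<Rightarrow> nat \<Rightarrow> nat \<Rightarrow> nat \<Rightarrow> complex poly" where
    "b i j k l = [:0, 2:]" for i j k l
  have upto2: "{..2::nat} = {0, 1, 2}"
    by auto
  have "(\<forall>i j k l. poly (b i j k l) s \<noteq> 0) \<and>
      (\<forall>q1 p1 q2 p2. Ham \<eta> \<alpha>1 \<alpha>2 q1 p1 q2 p2 s =
        (\<Sum>i\<le>2. \<Sum>j\<le>2. \<Sum>k\<le>2. \<Sum>l\<le>2.
          poly (a i j k l) s / poly (b i j k l) s * q1 ^ i * p1 ^ j * q2 ^ k * p2 ^ l))"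
    if "s \<noteq> 0" for s
    using that by (simp add: upto2 a_def b_def Ham_def K1_def K2_def field_simps)
  then show ?thesis
    unfolding polynomial_hamiltonian_def by blast
qed

lemma change_vars_new_unknowns_exist:
  assumes "inj_on (\<lambda>t. 1 / exp t) T"
  shows "\<exists>q1 p1 q2 p2. change_vars T x z w q q1 p1 q2 p2"
proof -
  define \<tau> where "\<tau> = inv_into T (\<lambda>t::complex. 1 / exp t)"
  have "\<tau> (1 / exp t) = t" if "t \<in> T" for t
    unfolding \<tau>_def by (rule inv_into_f_f[OF assms that])
  then have "change_vars T x z w q (\<lambda>s. w (\<tau> s)) (\<lambda>s. x (\<tau> s))
      (\<lambda>s. exp (\<tau> s) * q (\<tau> s)) (\<lambda>s. z (\<tau> s) / exp (\<tau> s))"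
    by (simp add: change_vars_def)
  then show ?thesis
    by blast
qed

lemma change_vars_old_unknowns_exist: "\<exists>x z w q. change_vars T x z w q q1 p1 q2 p2"
proof -
  have "change_vars T (\<lambda>t. p1 (1 / exp t)) (\<lambda>t. exp t * p2 (1 / exp t))
      (\<lambda>t. q1 (1 / exp t)) (\<lambda>t. q2 (1 / exp t) / exp t) q1 p1 q2 p2"
    by (simp add: change_vars_def)
  then show ?thesis
    by blast
qed

theorem theorem4p2:
  fixes \<alpha>0 \<alpha>1 \<alpha>2 \<eta> :: complex
  assumes "\<alpha>0 + \<alpha>1 + \<alpha>2 = 1"
  shows
    "(\<forall>T x y z w q q1 p1 q2 p2.
        open T \<and> (\<forall>t\<in>T. y t - w t * q t = exp (- t)) \<and> change_vars T x z w q q1 p1 q2 p2 \<longrightarrow>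
        (solves_5d \<alpha>0 \<alpha>1 \<alpha>2 \<eta> T x y z w q \<longleftrightarrow>
          solves_4d \<alpha>1 \<alpha>2 \<eta> ((\<lambda>t. 1 / exp t) ` T) q1 p1 q2 p2) \<and>
        (solves_5d \<alpha>0 \<alpha>1 \<alpha>2 \<eta> T x y z w q \<longleftrightarrow>
          solves_hamiltonian (Ham \<eta> \<alpha>1 \<alpha>2) ((\<lambda>t. 1 / exp t) ` T) q1 p1 q2 p2))
     \<and> (\<forall>T x z w q. inj_on (\<lambda>t. 1 / exp t) T \<longrightarrow>
          (\<exists>q1 p1 q2 p2. change_vars T x z w q q1 p1 q2 p2))
     \<and> (\<forall>T q1 p1 q2 p2. \<exists>x z w q. change_vars T x z w q q1 p1 q2 p2)
     \<and> (\<forall>q1 p1 q2 p2 s. s \<noteq> 0 \<longrightarrow>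
          ((\<lambda>p. Ham \<eta> \<alpha>1 \<alpha>2 q1 p q2 p2 s) has_field_derivative
            - q1\<^sup>2 * p1 / s + \<alpha>2 * q1 / s - p2 / s) (at p1) \<and>
          ((\<lambda>q. - Ham \<eta> \<alpha>1 \<alpha>2 q p1 q2 p2 s) has_field_derivative
            q1 * p1\<^sup>2 / s - \<alpha>2 * p1 / s - 1 / (2 * s)) (at q1) \<and>
          ((\<lambda>p. Ham \<eta> \<alpha>1 \<alpha>2 q1 p1 q2 p s) has_field_derivative
            - q2\<^sup>2 * p2 / s - (\<alpha>1 + \<alpha>2) * q2 / s - p1 / s) (at p2) \<and>
          ((\<lambda>q. - Ham \<eta> \<alpha>1 \<alpha>2 q1 p1 q p2 s) has_field_derivative
            q2 * p2\<^sup>2 / s + (\<alpha>1 + \<alpha>2) * p2 / s + \<eta> / 2) (at q2))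
     \<and> polynomial_hamiltonian (Ham \<eta> \<alpha>1 \<alpha>2)
     \<and> (\<forall>q1 p1 q2 p2 s. s \<noteq> 0 \<longrightarrow>
          Ham \<eta> \<alpha>1 \<alpha>2 q1 p1 q2 p2 s =
            - (q1\<^sup>2 * p1\<^sup>2 - 2 * \<alpha>2 * q1 * p1 - q1) / (2 * s)
            - (q2\<^sup>2 * p2\<^sup>2 + 2 * (\<alpha>1 + \<alpha>2) * q2 * p2 + \<eta> * s * q2) / (2 * s)
            - p1 * p2 / s)"
proof (intro conjI allI impI; (elim conjE)?)
  fix T x y z w q q1 p1 q2 p2
  assume T: "open T" and y: "\<forall>t\<in>T. y t - w t * q t = exp (- t)"
    and cv: "change_vars T x z w q q1 p1 q2 p2"
  show four: "solves_5d \<alpha>0 \<alpha>1 \<alpha>2 \<eta> T x y z w q \<longleftrightarrow>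
      solves_4d \<alpha>1 \<alpha>2 \<eta> ((\<lambda>t. 1 / exp t) ` T) q1 p1 q2 p2"
    using y by (intro solves_5d_iff_solves_4d[OF assms T _ cv]) auto
  have "0 \<notin> (\<lambda>t. 1 / exp t) ` T"
    by auto
  with four show "solves_5d \<alpha>0 \<alpha>1 \<alpha>2 \<eta> T x y z w q \<longleftrightarrow>
      solves_hamiltonian (Ham \<eta> \<alpha>1 \<alpha>2) ((\<lambda>t. 1 / exp t) ` T) q1 p1 q2 p2"
    by (simp add: solves_hamiltonian_Ham_iff_solves_4d)
next
  fix q1 p1 q2 p2 s :: complex
  assume "s \<noteq> 0"
  then show "Ham \<eta> \<alpha>1 \<alpha>2 q1 p1 q2 p2 s =
      - (q1\<^sup>2 * p1\<^sup>2 - 2 * \<alpha>2 * q1 * p1 - q1) / (2 * s)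
      - (q2\<^sup>2 * p2\<^sup>2 + 2 * (\<alpha>1 + \<alpha>2) * q2 * p2 + \<eta> * s * q2) / (2 * s)
      - p1 * p2 / s"
    by (simp add: Ham_def K1_def K2_def field_simps)
qed (fact change_vars_new_unknowns_exist change_vars_old_unknowns_exist
      Ham_partial_derivatives polynomial_hamiltonian_Ham)+

end
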